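(* Let $X$ be a Banach space whose norm has modulus of convexity of power type $2$. Let $U,V\subset X$ be open subsets and let $f:U\to V$ be a homeomorphism such that (i) $f:U\to V$ is Lip-differentiable at each point $x_0\in U$, and (ii) $f^{-1}:V\to U$ is locally Lipschitz at each point $y_0\in V$. Then $f$ is locally convex.
   Context: Modulus of convexity of a Banach space $X$ with closed unit ball $B_X$: $\delta_X(t)=\inf\{1-\|\frac{x+y}{2}\|: x,y\in B_X,\ \|x-y\|\ge t\}$ for $t\in(0,2]$. The norm of $X$ has modulus of convexity of power type $p$ if there is a constant $c>0$ with $\delta_X(t)\ge c\,t^p$ for all $t\in(0,2]$. Let $X,Y$ be Banach spaces and $U\subset X$ open. A function $f:U\to Y$ is: - differentiable at $x_0\in U$ if there is a continuous linear operator $f'_{x_0}:X\to Y$ with $\lim_{x\to x_0}\|f(x)-f(x_0)-f'_{x_0}(x-x_0)\|/\|x-x_0\|=0$; - Lip-differentiable at $x_0\in U$ if there is a neighborhood $W\subset U$ of $x_0$ such that $f$ is differentiable at each point of $W$ and $\sup_{x,y\in W,\,x\ne y}\|f(y)-f(x)-f'_x(y-x)\|/\|y-x\|^2<\infty$; - locally Lipschitz at $x_0\in U$ if there is a neighborhood $W\subset U$ of $x_0$ with $\sup_{x,y\in W,\,x\ne y}\|f(x)-f(y)\|/\|x-y\|<\infty$; - locally convex if for each $x\in U$ and each neighborhood $O_x\subset U$ of $x$ there is a convex open neighborhood $U_x\subset O_x$ of $x$ whose image $f(U_x)\subset Y$ is convex. *)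

theory Defs
  imports "HOL-Analysis.Analysis"
begin

text \<open>
  Neighbourhoods are not required to be open: \<open>W\<close> is a neighbourhood of \<open>x\<close> iff
  \<open>x \<in> interior W\<close>.

  The modulus of convexity takes values in \<^typ>\<open>ereal\<close> so that the infimum over the empty set,
  which occurs for the zero space, is \<open>\<infinity>\<close>; the infimum is never \<open>-\<infinity>\<close>.
\<close>

definition modulus_of_convexity :: "'a::real_normed_vector itself \<Rightarrow> real \<Rightarrow> ereal" where
  "modulus_of_convexity _ t =
     Inf {ereal (1 - norm ((x + y) /\<^sub>R 2)) | x y :: 'a.
            x \<in> cball 0 1 \<and> y \<in> cball 0 1 \<and> norm (x - y) \<ge> t}"

definition convexity_of_power_type :: "'a::real_normed_vector itself \<Rightarrow> real \<Rightarrow> bool" where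
  "convexity_of_power_type X p \<longleftrightarrow>
     (\<exists>c::real. c > 0 \<and> (\<forall>t\<in>{0<..2}. modulus_of_convexity X t \<ge> ereal (c * t powr p)))"

text \<open>
  In the following definitions only the values of \<open>f\<close> on \<open>U\<close> matter, provided \<open>U\<close> is open
  (so that the unrestricted \<open>at x\<close> only sees points of \<open>U\<close>).
\<close>

definition Lip_differentiable_at ::
    "('a::real_normed_vector \<Rightarrow> 'b::real_normed_vector) \<Rightarrow> 'a set \<Rightarrow> 'a \<Rightarrow> bool" where
  "Lip_differentiable_at f U x\<^sub>0 \<longleftrightarrow>
     (\<exists>W. W \<subseteq> U \<and> x\<^sub>0 \<in> interior W \<and>
        (\<forall>x\<in>W. f differentiable (at x)) \<and>
        bdd_above {norm (f y - f x - frechet_derivative f (at x) (y - x)) / norm (y - x) ^ 2 | x y.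
                     x \<in> W \<and> y \<in> W \<and> x \<noteq> y})"

definition locally_Lipschitz_at ::
    "('a::real_normed_vector \<Rightarrow> 'b::real_normed_vector) \<Rightarrow> 'a set \<Rightarrow> 'a \<Rightarrow> bool" where
  "locally_Lipschitz_at f U x\<^sub>0 \<longleftrightarrow>
     (\<exists>W. W \<subseteq> U \<and> x\<^sub>0 \<in> interior W \<and>
        bdd_above {norm (f x - f y) / norm (x - y) | x y. x \<in> W \<and> y \<in> W \<and> x \<noteq> y})"

definition locally_convex_map ::
    "('a::real_normed_vector \<Rightarrow> 'b::real_normed_vector) \<Rightarrow> 'a set \<Rightarrow> bool" where
  "locally_convex_map f U \<longleftrightarrow>
     (\<forall>x\<in>U. \<forall>N. N \<subseteq> U \<and> x \<in> interior N \<longrightarrow>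
        (\<exists>C. C \<subseteq> N \<and> x \<in> C \<and> open C \<and> convex C \<and> convex (f ` C)))"

end

theory Submission
  imports Defs
begin

text \<open>
  Every sufficiently small ball around \<open>x\<^sub>0\<close> has a convex image. For \<open>x, y\<close> at distance \<open>d\<close> in
  such a ball, put \<open>z = (1 - t) x + t y\<close> and \<open>w = (1 - t) f x + t f y\<close>. Expanding \<open>f\<close> at \<open>z\<close> cancels
  the first-order terms, so \<open>w\<close> is within \<open>L t (1 - t) d\<^sup>2\<close> of \<open>f z\<close>, and \<open>g w\<close> is within
  \<open>K L t (1 - t) d\<^sup>2\<close> of \<open>z\<close>. Convexity of power type 2 places \<open>z\<close> at depth at least
  \<open>2 c t (1 - t) d\<^sup>2 / r\<close> inside the ball of radius \<open>r\<close>, which exceeds this error for small \<open>r\<close>.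
\<close>

text \<open>The pair \<open>x\<close>, \<open>y\<close> itself competes in the infimum at
  \<open>t = norm (x - y)\<close>. This value is positive since \<open>x \<noteq> y\<close>, and at
  most 2 by the triangle inequality.\<close>

lemma power_type_midpoint:
  fixes x y :: "'a::real_normed_vector"
  assumes c: "\<forall>t\<in>{0<..2}. modulus_of_convexity TYPE('a) t \<ge> ereal (c * t powr p)"
    and xy: "norm x \<le> 1" "norm y \<le> 1" "x \<noteq> y"
  shows "norm ((x + y) /\<^sub>R 2) \<le> 1 - c * norm (x - y) powr p"
proof -
  let ?d = "norm (x - y)"
  have "?d \<le> 2"
    using norm_triangle_ineq4[of x y] xy by linarith
  then have "ereal (c * ?d powr p) \<le> modulus_of_convexity TYPE('a) ?d"
    using c xy by auto
  also have "\<dots> \<le> ereal (1 - norm ((x + y) /\<^sub>R 2))"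
    unfolding modulus_of_convexity_def
    by (rule Inf_lower) (use xy in auto)
  finally show ?thesis by simp
qed

text \<open>For \<open>t \<le> 1/2\<close> the point lies between \<open>x\<close> and the midpoint,
  with weight \<open>2*t\<close> on the midpoint. The triangle inequality therefore keeps the
  fraction \<open>2*t\<close> of the midpoint's gain
  \<open>c * (norm (x - y))\<^sup>2\<close>.\<close>

lemma power_type_2_convex_comb_half:
  fixes x y :: "'a::real_normed_vector"
  assumes c: "c \<ge> 0" "\<forall>t\<in>{0<..2}. modulus_of_convexity TYPE('a) t \<ge> ereal (c * t powr 2)"
    and xy: "norm x \<le> 1" "norm y \<le> 1" and t: "0 \<le> t" "t \<le> 1/2"
  shows "norm ((1 - t) *\<^sub>R x + t *\<^sub>R y) \<le> 1 - 2 * c * t * (1 - t) * (norm (x - y))\<^sup>2"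
proof (cases "x = y")
  case True
  then show ?thesis
    using xy by (simp flip: scaleR_left_distrib)
next
  case False
  let ?d = "norm (x - y)"
  have mid: "norm ((x + y) /\<^sub>R 2) \<le> 1 - c * ?d\<^sup>2"
    using power_type_midpoint[OF c(2) xy False] False by (simp add: powr_numeral)
  have "(1 - t) *\<^sub>R x + t *\<^sub>R y = (1 - 2*t) *\<^sub>R x + (2*t) *\<^sub>R ((x + y) /\<^sub>R 2)"
  proof -
    have "(1 - 2*t) *\<^sub>R x = (1 - t) *\<^sub>R x - t *\<^sub>R x"
      unfolding scaleR_left_diff_distrib[symmetric] by simp
    moreover have "(2*t) *\<^sub>R ((x + y) /\<^sub>R 2) = t *\<^sub>R x + t *\<^sub>R y"
      by (simp add: scaleR_right_distrib)
    ultimately show ?thesis by simp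
  qed
  then have "norm ((1 - t) *\<^sub>R x + t *\<^sub>R y)
      \<le> (1 - 2*t) * norm x + (2*t) * norm ((x + y) /\<^sub>R 2)"
    using t norm_triangle_ineq[of "(1 - 2*t) *\<^sub>R x" "(2*t) *\<^sub>R ((x + y) /\<^sub>R 2)"] by simp
  also have "\<dots> \<le> (1 - 2*t) * 1 + (2*t) * (1 - c * ?d\<^sup>2)"
    using t xy mid by (intro add_mono mult_left_mono) auto
  also have "\<dots> = 1 - 2 * c * t * ?d\<^sup>2"
    by (simp add: algebra_simps)
  \<comment> \<open>The factor \<open>1 - t\<close> only weakens the bound, but makes it symmetric
    under swapping \<open>t\<close> and \<open>1 - t\<close>, so that it can serve for all
    \<open>t\<close> in the unit interval.\<close>
  also have "\<dots> \<le> 1 - 2 * c * t * (1 - t) * ?d\<^sup>2"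
  proof -
    have "(2 * c * t * ?d\<^sup>2) * (1 - t) \<le> 2 * c * t * ?d\<^sup>2"
      using c t by (intro mult_left_le) auto
    then show ?thesis by (simp only: mult_ac)
  qed
  finally show ?thesis .
qed

text \<open>Rescale to the unit ball, exchanging the two points when \<open>t > 1/2\<close>. The
  squared distance contributes \<open>1 / r\<^sup>2\<close> and scaling back contributes
  \<open>r\<close>, so at a fixed distance the gain grows like \<open>1 / r\<close> as the ball
  shrinks.\<close>

lemma power_type_2_convex_comb:
  fixes x y :: "'a::real_normed_vector"
  assumes c: "c \<ge> 0" "\<forall>t\<in>{0<..2}. modulus_of_convexity TYPE('a) t \<ge> ereal (c * t powr 2)"
    and xy: "norm x \<le> r" "norm y \<le> r" and r: "r > 0" and t: "0 \<le> t" "t \<le> 1"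
  shows "norm ((1 - t) *\<^sub>R x + t *\<^sub>R y) \<le> r - 2 * c * t * (1 - t) * (norm (x - y))\<^sup>2 / r"
proof -
  define u where "u = x /\<^sub>R r"
  define v where "v = y /\<^sub>R r"
  have uv: "norm u \<le> 1" "norm v \<le> 1"
    using xy r by (auto simp: u_def v_def field_simps)
  have x: "x = r *\<^sub>R u" and y: "y = r *\<^sub>R v"
    using r by (auto simp: u_def v_def)
  have *: "norm ((1 - t) *\<^sub>R u + t *\<^sub>R v) \<le> 1 - 2 * c * t * (1 - t) * (norm (u - v))\<^sup>2"
  proof (cases "t \<le> 1/2")
    case True
    then show ?thesis using power_type_2_convex_comb_half[OF c uv] t by blast
  next
    case False
    then show ?thesis
      using power_type_2_convex_comb_half[OF c uv(2,1), of "1 - t"] t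
      by (simp add: norm_minus_commute add.commute mult_ac)
  qed
  have "(1 - t) *\<^sub>R x + t *\<^sub>R y = r *\<^sub>R ((1 - t) *\<^sub>R u + t *\<^sub>R v)"
    by (simp add: x y algebra_simps)
  then have "norm ((1 - t) *\<^sub>R x + t *\<^sub>R y) = r * norm ((1 - t) *\<^sub>R u + t *\<^sub>R v)"
    using r by simp
  also have "\<dots> \<le> r * (1 - 2 * c * t * (1 - t) * (norm (u - v))\<^sup>2)"
    using * r by (intro mult_left_mono) auto
  also have "\<dots> = r - 2 * c * t * (1 - t) * (norm (x - y))\<^sup>2 / r"
  proof -
    have "norm (x - y) = r * norm (u - v)"
      using r by (simp add: x y flip: scaleR_diff_right)
    then show ?thesis
      using r by (simp add: power2_eq_square field_simps)
  qed
  finally show ?thesis .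
qed

text \<open>One ball and one constant now serve all pairs of points. The case \<open>x = y\<close>,
  absent from the quotients in the definition, holds because the derivative vanishes at 0.\<close>

lemma Lip_differentiable_atE:
  assumes "Lip_differentiable_at f U x\<^sub>0"
  obtains e L where "e > 0" "L > 0" "ball x\<^sub>0 e \<subseteq> U"
    "\<And>x. x \<in> ball x\<^sub>0 e \<Longrightarrow> bounded_linear (frechet_derivative f (at x))"
    "\<And>x y. x \<in> ball x\<^sub>0 e \<Longrightarrow> y \<in> ball x\<^sub>0 e \<Longrightarrow>
       norm (f y - f x - frechet_derivative f (at x) (y - x)) \<le> L * (norm (y - x))\<^sup>2"
proof -
  obtain W where W: "W \<subseteq> U" "x\<^sub>0 \<in> interior W" "\<And>x. x \<in> W \<Longrightarrow> f differentiable (at x)"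
    and bdd: "bdd_above {norm (f y - f x - frechet_derivative f (at x) (y - x)) / norm (y - x) ^ 2 | x y.
                x \<in> W \<and> y \<in> W \<and> x \<noteq> y}"
    using assms unfolding Lip_differentiable_at_def by auto
  obtain M where M: "\<And>x y. x \<in> W \<Longrightarrow> y \<in> W \<Longrightarrow> x \<noteq> y \<Longrightarrow>
       norm (f y - f x - frechet_derivative f (at x) (y - x)) / (norm (y - x))\<^sup>2 \<le> M"
    using bdd unfolding bdd_above_def by blast
  obtain e where e: "e > 0" "ball x\<^sub>0 e \<subseteq> W"
    using W(2) unfolding mem_interior by blast
  have lin: "bounded_linear (frechet_derivative f (at x))" if "x \<in> ball x\<^sub>0 e" for x
  proof -
    have "f differentiable (at x)"
      using W(3) e(2) that by auto
    then show ?thesis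
      unfolding frechet_derivative_works by (rule has_derivative_bounded_linear)
  qed
  show thesis
  \<comment> \<open>The upper bound \<open>M\<close> may be zero or negative; this replacement is
    positive, so that one can later divide by it.\<close>
  proof (rule that[of e "\<bar>M\<bar> + 1"])
    fix x y assume *: "x \<in> ball x\<^sub>0 e" "y \<in> ball x\<^sub>0 e"
    show "norm (f y - f x - frechet_derivative f (at x) (y - x)) \<le> (\<bar>M\<bar> + 1) * (norm (y - x))\<^sup>2"
    proof (cases "x = y")
      case True
      then show ?thesis using linear_0[OF bounded_linear.linear[OF lin[OF *(1)]]] by simp
    next
      case False
      then have "norm (f y - f x - frechet_derivative f (at x) (y - x)) \<le> M * (norm (y - x))\<^sup>2"
        using M[OF subsetD[OF e(2) *(1)] subsetD[OF e(2) *(2)]] by (simp add: divide_le_eq)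
      also have "\<dots> \<le> (\<bar>M\<bar> + 1) * (norm (y - x))\<^sup>2"
        by (intro mult_right_mono) auto
      finally show ?thesis .
    qed
  qed (use e W lin in auto)
qed

lemma locally_Lipschitz_atE:
  assumes "locally_Lipschitz_at f U x\<^sub>0"
  obtains e K where "e > 0" "K > 0" "ball x\<^sub>0 e \<subseteq> U"
    "\<And>x y. x \<in> ball x\<^sub>0 e \<Longrightarrow> y \<in> ball x\<^sub>0 e \<Longrightarrow> norm (f x - f y) \<le> K * norm (x - y)"
proof -
  obtain W M where W: "W \<subseteq> U" "x\<^sub>0 \<in> interior W"
    and M: "\<And>x y. x \<in> W \<Longrightarrow> y \<in> W \<Longrightarrow> x \<noteq> y \<Longrightarrow> norm (f x - f y) / norm (x - y) \<le> M"
    using assms unfolding locally_Lipschitz_at_def bdd_above_def by blast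
  obtain e where e: "e > 0" "ball x\<^sub>0 e \<subseteq> W"
    using W(2) unfolding mem_interior by blast
  show thesis
  proof (rule that[of e "\<bar>M\<bar> + 1"])
    fix x y assume *: "x \<in> ball x\<^sub>0 e" "y \<in> ball x\<^sub>0 e"
    show "norm (f x - f y) \<le> (\<bar>M\<bar> + 1) * norm (x - y)"
    proof (cases "x = y")
      case False
      then have "norm (f x - f y) \<le> M * norm (x - y)"
        using M[OF subsetD[OF e(2) *(1)] subsetD[OF e(2) *(2)]] by (simp add: divide_le_eq)
      also have "\<dots> \<le> (\<bar>M\<bar> + 1) * norm (x - y)"
        by (intro mult_right_mono) auto
      finally show ?thesis .
    qed simp
  qed (use e W in auto)
qed

text \<open>Both expansions are based at \<open>z\<close>, and the weighted displacements
  \<open>x - z\<close> and \<open>y - z\<close> sum to 0. Any linear \<open>D\<close> thus drops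
  out, and only the quadratic remainders survive.\<close>

lemma convex_comb_second_order_error:
  fixes f :: "'a::real_normed_vector \<Rightarrow> 'b::real_normed_vector"
  assumes D: "linear D" and t: "0 \<le> t" "t \<le> 1"
    and z: "z = (1 - t) *\<^sub>R x + t *\<^sub>R y"
    and x: "norm (f x - f z - D (x - z)) \<le> L * (norm (x - z))\<^sup>2"
    and y: "norm (f y - f z - D (y - z)) \<le> L * (norm (y - z))\<^sup>2"
  shows "norm ((1 - t) *\<^sub>R f x + t *\<^sub>R f y - f z) \<le> L * t * (1 - t) * (norm (x - y))\<^sup>2"
proof -
  have xz: "x - z = t *\<^sub>R (x - y)" and yz: "y - z = (1 - t) *\<^sub>R (y - x)"
    by (simp_all add: z algebra_simps)
  have "(1 - t) *\<^sub>R D (x - z) + t *\<^sub>R D (y - z) = D ((1 - t) *\<^sub>R (x - z) + t *\<^sub>R (y - z))"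
    by (simp add: linear_add[OF D] linear_cmul[OF D])
  also have "(1 - t) *\<^sub>R (x - z) + t *\<^sub>R (y - z) = 0"
    by (simp add: z algebra_simps)
  finally have "(1 - t) *\<^sub>R D (x - z) + t *\<^sub>R D (y - z) = 0"
    by (simp add: linear_0[OF D])
  moreover have "(1 - t) *\<^sub>R (f x - f z - D (x - z)) + t *\<^sub>R (f y - f z - D (y - z))
      = (1 - t) *\<^sub>R f x + t *\<^sub>R f y - f z - ((1 - t) *\<^sub>R D (x - z) + t *\<^sub>R D (y - z))"
    by (simp add: algebra_simps)
  ultimately have "(1 - t) *\<^sub>R f x + t *\<^sub>R f y - f z
      = (1 - t) *\<^sub>R (f x - f z - D (x - z)) + t *\<^sub>R (f y - f z - D (y - z))"
    by simp
  then have "norm ((1 - t) *\<^sub>R f x + t *\<^sub>R f y - f z)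
      \<le> (1 - t) * norm (f x - f z - D (x - z)) + t * norm (f y - f z - D (y - z))"
    using t norm_triangle_ineq[of "(1 - t) *\<^sub>R (f x - f z - D (x - z))"
        "t *\<^sub>R (f y - f z - D (y - z))"] by simp
  also have "\<dots> \<le> (1 - t) * (L * (norm (x - z))\<^sup>2) + t * (L * (norm (y - z))\<^sup>2)"
    using t x y by (intro add_mono mult_left_mono) auto
  \<comment> \<open>The weights combine through
    \<open>(1 - t) * t\<^sup>2 + t * (1 - t)\<^sup>2 = t * (1 - t)\<close>, the same factor as in
    the convexity estimate.\<close>
  also have "\<dots> = L * t * (1 - t) * (norm (x - y))\<^sup>2"
    using t by (simp add: xz yz norm_minus_commute[of y x] power_mult_distrib)
      (simp add: algebra_simps power2_eq_square)
  finally show ?thesis .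
qed

theorem theorem1:
  fixes f g :: "'a::banach \<Rightarrow> 'a" and U V :: "'a set"
  assumes "convexity_of_power_type TYPE('a) 2"
    and "open U" and "open V"
    and "homeomorphism U V f g"
    and "\<And>x\<^sub>0. x\<^sub>0 \<in> U \<Longrightarrow> Lip_differentiable_at f U x\<^sub>0"
    and "\<And>y\<^sub>0. y\<^sub>0 \<in> V \<Longrightarrow> locally_Lipschitz_at g V y\<^sub>0"
  shows "locally_convex_map f U"
  unfolding locally_convex_map_def
proof (intro ballI allI impI)
  fix x\<^sub>0 N assume x0: "x\<^sub>0 \<in> U" and N: "N \<subseteq> U \<and> x\<^sub>0 \<in> interior N"
  have fg: "\<And>x. x \<in> U \<Longrightarrow> g (f x) = x" "\<And>y. y \<in> V \<Longrightarrow> f (g y) = y"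
    and contf: "continuous_on U f" and "f x\<^sub>0 \<in> V"
    using assms(4) x0 by (auto simp: homeomorphism_def)
  obtain c where c: "c > 0"
    "\<forall>t\<in>{0<..2}. modulus_of_convexity TYPE('a) t \<ge> ereal (c * t powr 2)"
    using assms(1) unfolding convexity_of_power_type_def by blast
  obtain e L where L: "e > 0" "L > 0" "ball x\<^sub>0 e \<subseteq> U"
    "\<And>x. x \<in> ball x\<^sub>0 e \<Longrightarrow> bounded_linear (frechet_derivative f (at x))"
    "\<And>x y. x \<in> ball x\<^sub>0 e \<Longrightarrow> y \<in> ball x\<^sub>0 e \<Longrightarrow>
       norm (f y - f x - frechet_derivative f (at x) (y - x)) \<le> L * (norm (y - x))\<^sup>2"
    using Lip_differentiable_atE[OF assms(5)[OF x0]] by metis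
  obtain s K where K: "s > 0" "K > 0" "ball (f x\<^sub>0) s \<subseteq> V"
    "\<And>x y. x \<in> ball (f x\<^sub>0) s \<Longrightarrow> y \<in> ball (f x\<^sub>0) s \<Longrightarrow> norm (g x - g y) \<le> K * norm (x - y)"
    using locally_Lipschitz_atE[OF assms(6)[OF \<open>f x\<^sub>0 \<in> V\<close>]] by metis
  obtain \<eta> where \<eta>: "\<eta> > 0" "ball x\<^sub>0 \<eta> \<subseteq> N"
    using N unfolding mem_interior by blast
  obtain d where d: "d > 0" "\<And>x. x \<in> U \<Longrightarrow> dist x x\<^sub>0 < d \<Longrightarrow> dist (f x) (f x\<^sub>0) < s"
    using contf x0 K(1) unfolding continuous_on_iff by metis
  \<comment> \<open>The four bounds keep the ball where the expansion of \<open>f\<close> holds,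
    inside \<open>N\<close>, and mapped by \<open>f\<close> into the ball on which \<open>g\<close>
    is Lipschitz, and make the convexity gain dominate the error.\<close>
  define r where "r = Min {e, \<eta>, d, 2 * c / (K * L)}"
  have r: "r > 0" "r \<le> e" "r \<le> \<eta>" "r \<le> d" "r \<le> 2 * c / (K * L)"
    using L K \<eta> d c by (auto simp: r_def)
  have fball: "f x \<in> ball (f x\<^sub>0) s" if "x \<in> ball x\<^sub>0 r" for x
    using d(2)[of x] that r L(3) by (auto simp: dist_commute subset_iff)
  have "(1 - t) *\<^sub>R f x + t *\<^sub>R f y \<in> f ` ball x\<^sub>0 r"
    if xy: "x \<in> ball x\<^sub>0 r" "y \<in> ball x\<^sub>0 r" and t: "0 \<le> t" "t \<le> 1" for x y t
  proof (cases "x = y")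
    case True
    then show ?thesis using xy by (simp flip: scaleR_left_distrib)
  next
    case False
    define z where "z = (1 - t) *\<^sub>R x + t *\<^sub>R y"
    define w where "w = (1 - t) *\<^sub>R f x + t *\<^sub>R f y"
    define q where "q = t * (1 - t) * (norm (x - y))\<^sup>2"
    have q: "q \<ge> 0"
      using t by (simp add: q_def)
    have z: "z \<in> ball x\<^sub>0 r"
      unfolding z_def using convexD_alt[OF convex_ball xy t] by simp
    \<comment> \<open>Convexity of the target ball suffices here: \<open>w\<close> lies in
      \<open>V\<close> before it is known to be in the image, so \<open>g w\<close> is the candidate
      preimage.\<close>
    have w: "w \<in> ball (f x\<^sub>0) s"
      unfolding w_def using convexD_alt[OF convex_ball fball[OF xy(1)] fball[OF xy(2)] t] by simp
    have in_e: "x \<in> ball x\<^sub>0 e" "y \<in> ball x\<^sub>0 e" "z \<in> ball x\<^sub>0 e"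
      using xy z r by auto
    have "norm (w - f z) \<le> L * q"
      unfolding w_def q_def
      using convex_comb_second_order_error[OF bounded_linear.linear[OF L(4)[OF in_e(3)]] t z_def
          L(5)[OF in_e(3,1)] L(5)[OF in_e(3,2)]]
      by (simp add: mult_ac)
    then have "K * norm (w - f z) \<le> K * (L * q)"
      using K by (intro mult_left_mono) auto
    moreover have "norm (g w - z) \<le> K * norm (w - f z)"
      using K(4)[OF w fball[OF z]] fg(1) in_e(3) L(3) by (metis subsetD)
    ultimately have gw: "norm (g w - z) \<le> K * L * q"
      by simp
    \<comment> \<open>the radius is shrunk to the larger of the two norms to get a strict inequality at the end\<close>
    define \<rho> where "\<rho> = max (norm (x - x\<^sub>0)) (norm (y - x\<^sub>0))"
    \<comment> \<open>Positivity holds because distinct \<open>x\<close> and \<open>y\<close> cannot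
      both equal the centre.\<close>
    have \<rho>: "\<rho> > 0" "\<rho> < r"
      using False xy by (auto simp: \<rho>_def less_max_iff_disj dist_norm norm_minus_commute)
    have zx0: "z - x\<^sub>0 = (1 - t) *\<^sub>R (x - x\<^sub>0) + t *\<^sub>R (y - x\<^sub>0)"
      by (simp add: z_def algebra_simps)
    have nz: "norm (z - x\<^sub>0) \<le> \<rho> - 2 * c / \<rho> * q"
    proof -
      have "norm (x - x\<^sub>0) \<le> \<rho>" "norm (y - x\<^sub>0) \<le> \<rho>"
        by (auto simp: \<rho>_def)
      then show ?thesis
        using power_type_2_convex_comb[OF less_imp_le[OF c(1)] c(2) _ _ \<rho>(1) t,
            of "x - x\<^sub>0" "y - x\<^sub>0"]
        unfolding zx0 q_def by (simp add: mult.assoc)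
    qed
    \<comment> \<open>This turns the last bound on \<open>r\<close> into a comparison of
      coefficients of \<open>q\<close>: the error coefficient \<open>K * L\<close> is at most the
      depth coefficient \<open>2 * c / \<rho>\<close>. The two terms then cancel and leave
      \<open>norm (g w - x\<^sub>0) \<le> \<rho> < r\<close>.\<close>
    have "\<rho> \<le> 2 * c / (K * L)"
      using \<rho> r by linarith
    then have "K * L \<le> 2 * c / \<rho>"
      using K L \<rho> by (simp add: field_simps)
    then have "K * L * q \<le> 2 * c / \<rho> * q"
      using q by (intro mult_right_mono)
    then have "norm (g w - x\<^sub>0) < r"
      using gw nz \<rho> norm_triangle_ineq[of "g w - z" "z - x\<^sub>0"] by simp
    then have "g w \<in> ball x\<^sub>0 r"
      by (simp add: dist_norm norm_minus_commute)
    moreover have "w = f (g w)"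
      using fg(2) w K(3) by auto
    ultimately show ?thesis
      unfolding w_def by blast
  qed
  then have "convex (f ` ball x\<^sub>0 r)"
    unfolding convex_alt by blast
  moreover have "ball x\<^sub>0 r \<subseteq> N"
    using \<eta> r by auto
  ultimately show "\<exists>C. C \<subseteq> N \<and> x\<^sub>0 \<in> C \<and> open C \<and> convex C \<and> convex (f ` C)"
    using r by (intro exI[of _ "ball x\<^sub>0 r"]) auto
qed

end
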